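(* Let $A$ be a $B_1$-algebra. The mappings $\alpha_A : Pr_s(A)\to MaxSpec(A)$, $\mathcal P\mapsto \mathcal S_{\mathcal P}$, and $\beta_A : MaxSpec(A)\to Pr_s(A)$, $\mathcal R\mapsto I(\mathcal R)$, are bijections, inverse of one another. They are continuous for the topologies on $Pr_s(A)$ and $MaxSpec(A)$ induced by the Zariski-type topologies on $Pr(A)$ and $Spec(A)$ respectively; hence $Pr_s(A)$ and $MaxSpec(A)$ are homeomorphic.
   Context: A (commutative) $B_1$-algebra is a commutative semiring $A$ with $0$ (absorbing for multiplication) and $1$, in which $1+1=1$ (so $x+x=x$ for all $x\in A$). An ideal of $A$ is a subset containing $0$, stable under addition and under multiplication by elements of $A$. An ideal $\mathcal P$ is prime if $\mathcal P\neq A$ and $ab\in\mathcal P$ implies $a\in\mathcal P$ or $b\in\mathcal P$. A congruence on $A$ is an equivalence relation compatible with addition and multiplication; the trivial congruence is the one under which any two elements are equivalent. Congruences are ordered by inclusion. For a congruence $\mathcal R$, $I(\mathcal R):=\{x\in A \mid x\,\mathcal R\,0\}$, which is an ideal. An ideal $J$ is saturated if $J=I(\mathcal R)$ for some congruence $\mathcal R$. A nontrivial congruence $\mathcal R$ is prime if $ab\,\mathcal R\,0$ implies $a\,\mathcal R\,0$ or $b\,\mathcal R\,0$. $Spec(A)$ is the set of prime congruences and $MaxSpec(A)$ the set of maximal elements among nontrivial congruences; one has $MaxSpec(A)\subseteq Spec(A)$. $Pr(A)$ is the set of prime ideals and $Pr_s(A)$ the set of saturated prime ideals. The closed sets of $Pr(A)$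 are the sets $W(S):=\{\mathcal P\in Pr(A)\mid S\subseteq\mathcal P\}$, $S\subseteq A$; the closed sets of $Spec(A)$ are the sets $V(S):=\{\mathcal R\in Spec(A)\mid S\subseteq I(\mathcal R)\}$, $S\subseteq A$. For $\mathcal P\in Pr_s(A)$, $\mathcal S_{\mathcal P}$ is the relation on $A$ defined by: $x\,\mathcal S_{\mathcal P}\,y$ if and only if ($x\in\mathcal P$ and $y\in\mathcal P$) or ($x\notin\mathcal P$ and $y\notin\mathcal P$). It is a congruence belonging to $MaxSpec(A)$; and for $\mathcal R\in MaxSpec(A)$ one has $I(\mathcal R)\in Pr_s(A)$. *)

theory Defs
  imports "HOL-Analysis.Abstract_Topology"
begin

text \<open>
  The class \<open>comm_semiring_1\<close> is not used here because it requires \<open>0 \<noteq> 1\<close>;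
  the one-element algebra is a \<open>B\<^sub>1\<close>-algebra.
\<close>

class b1_algebra = comm_semiring_0 + comm_monoid_mult +
  assumes one_add_one: "1 + 1 = 1"
begin

lemma add_idem: "x + x = x"
  by (metis distrib_left mult_1_right one_add_one)

end

definition is_ideal :: "'a::b1_algebra set \<Rightarrow> bool" where
  "is_ideal J \<longleftrightarrow> 0 \<in> J \<and> (\<forall>x\<in>J. \<forall>y\<in>J. x + y \<in> J) \<and> (\<forall>a. \<forall>x\<in>J. a * x \<in> J)"

definition prime_ideal :: "'a::b1_algebra set \<Rightarrow> bool" where
  "prime_ideal P \<longleftrightarrow> is_ideal P \<and> P \<noteq> UNIV \<and> (\<forall>a b. a * b \<in> P \<longrightarrow> a \<in> P \<or> b \<in> P)"

definition is_congruence :: "('a::b1_algebra \<times> 'a) set \<Rightarrow> bool" where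
  "is_congruence R \<longleftrightarrow> equiv UNIV R \<and>
     (\<forall>x x' y y'. (x, x') \<in> R \<longrightarrow> (y, y') \<in> R \<longrightarrow>
        (x + y, x' + y') \<in> R \<and> (x * y, x' * y') \<in> R)"

text \<open>Following the convention of the theory, the \<^emph>\<open>trivial\<close> congruence is the total one.\<close>

definition nontrivial_congruence :: "('a::b1_algebra \<times> 'a) set \<Rightarrow> bool" where
  "nontrivial_congruence R \<longleftrightarrow> is_congruence R \<and> R \<noteq> UNIV"

definition ideal_of :: "('a::b1_algebra \<times> 'a) set \<Rightarrow> 'a set" where
  "ideal_of R = {x. (x, 0) \<in> R}"

definition saturated :: "'a::b1_algebra set \<Rightarrow> bool" where
  "saturated J \<longleftrightarrow> is_ideal J \<and> (\<exists>R. is_congruence R \<and> J = ideal_of R)"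

definition prime_congruence :: "('a::b1_algebra \<times> 'a) set \<Rightarrow> bool" where
  "prime_congruence R \<longleftrightarrow> nontrivial_congruence R \<and>
     (\<forall>a b. (a * b, 0) \<in> R \<longrightarrow> (a, 0) \<in> R \<or> (b, 0) \<in> R)"

definition Spec :: "('a::b1_algebra \<times> 'a) set set" where
  "Spec = {R. prime_congruence R}"

definition MaxSpec :: "('a::b1_algebra \<times> 'a) set set" where
  "MaxSpec = {R. nontrivial_congruence R \<and>
     (\<forall>R'. nontrivial_congruence R' \<longrightarrow> R \<subseteq> R' \<longrightarrow> R' = R)}"

definition Pr :: "'a::b1_algebra set set" where
  "Pr = {P. prime_ideal P}"

definition Pr_s :: "'a::b1_algebra set set" where
  "Pr_s = {P. prime_ideal P \<and> saturated P}"

definition W :: "'a::b1_algebra set \<Rightarrow> 'a set set" where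
  "W S = {P \<in> Pr. S \<subseteq> P}"

definition V :: "'a::b1_algebra set \<Rightarrow> ('a \<times> 'a) set set" where
  "V S = {R \<in> Spec. S \<subseteq> ideal_of R}"

definition zariski_Pr :: "'a::b1_algebra set topology" where
  "zariski_Pr = topology (\<lambda>U. \<exists>S. U = Pr - W S)"

definition zariski_Spec :: "('a::b1_algebra \<times> 'a) set topology" where
  "zariski_Spec = topology (\<lambda>U. \<exists>S. U = Spec - V S)"

definition S_rel :: "'a::b1_algebra set \<Rightarrow> ('a \<times> 'a) set" where
  "S_rel P = {(x, y). (x \<in> P \<and> y \<in> P) \<or> (x \<notin> P \<and> y \<notin> P)}"

text \<open>
  The families used in \<open>zariski_Pr\<close> and \<open>zariski_Spec\<close> are topologies, so the
  closed sets are exactly the \<open>W S\<close> and the \<open>V S\<close>.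
\<close>

lemma is_ideal_ideal_of:
  assumes "is_congruence R"
  shows "is_ideal (ideal_of R)"
proof -
  have r: "(x, x) \<in> R" for x
    using assms by (auto simp: is_congruence_def equiv_def refl_on_def)
  have c: "(x + y, x' + y') \<in> R \<and> (x * y, x' * y') \<in> R" if "(x, x') \<in> R" "(y, y') \<in> R" for x x' y y'
    using assms that by (auto simp: is_congruence_def)
  show ?thesis
    unfolding is_ideal_def ideal_of_def
    using r c[of _ 0 _ 0] c[OF r, of _ 0] by auto
qed

lemma prime_ideal_ideal_of:
  assumes "prime_congruence R"
  shows "prime_ideal (ideal_of R)"
proof -
  have cR: "is_congruence R" and "R \<noteq> UNIV"
    using assms by (auto simp: prime_congruence_def nontrivial_congruence_def)
  then have e: "equiv UNIV R"
    by (simp add: is_congruence_def)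
  obtain x y where "(x, y) \<notin> R"
    using \<open>R \<noteq> UNIV\<close> by auto
  then have "\<not> ((x, 0) \<in> R \<and> (y, 0) \<in> R)"
    using e by (meson equivE symE transE)
  then have "ideal_of R \<noteq> UNIV"
    by (auto simp: ideal_of_def)
  then show ?thesis
    using assms is_ideal_ideal_of[OF cR]
    by (auto simp: prime_ideal_def prime_congruence_def ideal_of_def)
qed

lemma V_eq: "V S = {R \<in> Spec. ideal_of R \<in> W S}"
  by (auto simp: V_def W_def Pr_def Spec_def prime_ideal_ideal_of)

lemma prime_ideal_products_subset:
  assumes "prime_ideal P"
  shows "{s * t | s t. s \<in> S \<and> t \<in> T} \<subseteq> P \<longleftrightarrow> S \<subseteq> P \<or> T \<subseteq> P"
proof -
  have id: "\<And>a x. x \<in> P \<Longrightarrow> a * x \<in> P"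
    using assms by (auto simp: prime_ideal_def is_ideal_def)
  have id': "x * a \<in> P" if "x \<in> P" for a x
    using id[OF that] by (simp add: mult.commute)
  have pr: "\<And>a b. a * b \<in> P \<Longrightarrow> a \<in> P \<or> b \<in> P"
    using assms by (auto simp: prime_ideal_def)
  show ?thesis
  proof
    assume *: "{s * t | s t. s \<in> S \<and> t \<in> T} \<subseteq> P"
    show "S \<subseteq> P \<or> T \<subseteq> P"
    proof (rule ccontr)
      assume "\<not> (S \<subseteq> P \<or> T \<subseteq> P)"
      then obtain s t where st: "s \<in> S" "s \<notin> P" "t \<in> T" "t \<notin> P"
        by auto
      then have "s * t \<in> P"
        using * by auto
      then show False
        using pr st by auto
    qed
  next
    assume "S \<subseteq> P \<or> T \<subseteq> P"
    then show "{s * t | s t. s \<in> S \<and> t \<in> T} \<subseteq> P"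
      using id id' by auto
  qed
qed

lemma W_Un: "W S \<union> W T = W {s * t | s t. s \<in> S \<and> t \<in> T}"
proof (rule set_eqI)
  fix P :: "'a set"
  show "P \<in> W S \<union> W T \<longleftrightarrow> P \<in> W {s * t | s t. s \<in> S \<and> t \<in> T}"
    unfolding W_def Pr_def Un_iff mem_Collect_eq
    using prime_ideal_products_subset[of P S T] by argo
qed

lemma W_UNIV: "W UNIV = {}"
  by (auto simp: W_def Pr_def prime_ideal_def)

lemma istopology_zariski_Pr: "istopology (\<lambda>U. \<exists>S. U = Pr - W S)"
  unfolding istopology_def
proof (intro conjI allI impI)
  fix U U' :: "'a set set"
  assume "\<exists>S. U = Pr - W S" "\<exists>S. U' = Pr - W S"
  then obtain S T where "U = Pr - W S" "U' = Pr - W T"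
    by blast
  then have "U \<inter> U' = Pr - W {s * t | s t. s \<in> S \<and> t \<in> T}"
    unfolding W_Un[symmetric] by blast
  then show "\<exists>S. U \<inter> U' = Pr - W S"
    by blast
next
  fix \<K> :: "'a set set set"
  assume "\<forall>U\<in>\<K>. \<exists>S. U = Pr - W S"
  then obtain f where f: "\<And>U. U \<in> \<K> \<Longrightarrow> U = Pr - W (f U)"
    by metis
  have "(\<Union>U\<in>\<K>. U) = (\<Union>U\<in>\<K>. Pr - W (f U))"
    by (rule SUP_cong[OF refl]) (erule f)
  then have "\<Union>\<K> = Pr - W (\<Union>(f ` \<K>))"
    by (auto simp: W_def)
  then show "\<exists>S. \<Union>\<K> = Pr - W S"
    by blast
qed

lemma istopology_zariski_Spec: "istopology (\<lambda>U. \<exists>S. U = Spec - V S)"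
  unfolding istopology_def
proof (intro conjI allI impI)
  fix U U' :: "('a \<times> 'a) set set"
  assume "\<exists>S. U = Spec - V S" "\<exists>S. U' = Spec - V S"
  then obtain S T where "U = Spec - V S" "U' = Spec - V T"
    by blast
  then have "U \<inter> U' = Spec - V {s * t | s t. s \<in> S \<and> t \<in> T}"
    unfolding V_eq W_Un[symmetric] by blast
  then show "\<exists>S. U \<inter> U' = Spec - V S"
    by blast
next
  fix \<K> :: "('a \<times> 'a) set set set"
  assume "\<forall>U\<in>\<K>. \<exists>S. U = Spec - V S"
  then obtain f where f: "\<And>U. U \<in> \<K> \<Longrightarrow> U = Spec - V (f U)"
    by metis
  have "(\<Union>U\<in>\<K>. U) = (\<Union>U\<in>\<K>. Spec - V (f U))"
    by (rule SUP_cong[OF refl]) (erule f)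
  then have "\<Union>\<K> = Spec - V (\<Union>(f ` \<K>))"
    by (auto simp: V_def)
  then show "\<exists>S. \<Union>\<K> = Spec - V S"
    by blast
qed

lemma openin_zariski_Pr: "openin zariski_Pr U \<longleftrightarrow> (\<exists>S. U = Pr - W S)"
  unfolding zariski_Pr_def by (simp add: istopology_zariski_Pr)

lemma openin_zariski_Spec: "openin zariski_Spec U \<longleftrightarrow> (\<exists>S. U = Spec - V S)"
  unfolding zariski_Spec_def by (simp add: istopology_zariski_Spec)

lemma topspace_zariski_Pr: "topspace zariski_Pr = Pr"
  unfolding topspace_def openin_zariski_Pr using W_UNIV by blast

lemma topspace_zariski_Spec: "topspace zariski_Spec = Spec"
proof -
  have "V UNIV = ({} :: ('a \<times> 'a) set set)"
    by (simp add: V_eq W_UNIV)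
  then show ?thesis
    unfolding topspace_def openin_zariski_Spec by blast
qed

lemma closedin_zariski_Pr: "closedin zariski_Pr C \<longleftrightarrow> (\<exists>S. C = W S)"
proof -
  have "W S \<subseteq> Pr" for S :: "'a set"
    by (auto simp: W_def)
  then show ?thesis
    unfolding closedin_def topspace_zariski_Pr openin_zariski_Pr
    by (metis Diff_Diff_Int inf.absorb_iff2)
qed

lemma closedin_zariski_Spec: "closedin zariski_Spec C \<longleftrightarrow> (\<exists>S. C = V S)"
proof -
  have "V S \<subseteq> Spec" for S :: "'a set"
    by (auto simp: V_def)
  then show ?thesis
    unfolding closedin_def topspace_zariski_Spec openin_zariski_Spec
    by (metis Diff_Diff_Int inf.absorb_iff2)
qed

text \<open>
  \<open>subtopology X T\<close> has \<open>topspace X \<inter> T\<close> as its underlying set; here this is \<open>T\<close>.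
\<close>

lemma MaxSpec_subset_Spec: "MaxSpec \<subseteq> Spec"
proof
  fix R :: "('a \<times> 'a) set"
  assume R: "R \<in> MaxSpec"
  then have cR: "is_congruence R" and nt: "nontrivial_congruence R"
    and mx: "\<And>R'. nontrivial_congruence R' \<Longrightarrow> R \<subseteq> R' \<Longrightarrow> R' = R"
    by (auto simp: MaxSpec_def nontrivial_congruence_def)
  have rf: "(x, x) \<in> R" for x
    using cR by (auto simp: is_congruence_def equiv_def refl_on_def)
  have sy: "(y, x) \<in> R" if "(x, y) \<in> R" for x y
    using cR that by (meson is_congruence_def equivE symE)
  have tr: "(x, z) \<in> R" if "(x, y) \<in> R" "(y, z) \<in> R" for x y z
    using cR that by (meson is_congruence_def equivE transE)
  have ad: "(x + y, x' + y') \<in> R" and mu: "(x * y, x' * y') \<in> R"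
    if "(x, x') \<in> R" "(y, y') \<in> R" for x x' y y'
    using cR that by (auto simp: is_congruence_def)
  have "(b, 0) \<in> R" if ab: "(a * b, 0) \<in> R" and a: "(a, 0) \<notin> R" for a b
  proof -
    let ?R' = "{(x, y). (a * x, a * y) \<in> R}"
    have "equiv UNIV ?R'"
    proof (rule equivI)
      show "refl ?R'" by (auto simp: refl_on_def rf)
      show "sym ?R'" by (auto simp: sym_def dest: sy)
      show "trans ?R'" unfolding trans_def using tr by blast
    qed simp
    moreover have "(a * (x * y), a * (x' * y')) \<in> R"
      if x: "(a * x, a * x') \<in> R" and y: "(a * y, a * y') \<in> R" for x x' y y'
    proof -
      have "(a * (x * y), a * (x' * y)) \<in> R"
        using mu[OF x rf[of y]] by (simp add: mult.assoc)
      moreover have "(a * (x' * y), a * (x' * y')) \<in> R"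
        using mu[OF rf[of x'] y] by (simp add: mult.left_commute)
      ultimately show ?thesis by (rule tr)
    qed
    ultimately have "is_congruence ?R'"
      by (auto simp: is_congruence_def distrib_left intro: ad)
    moreover have "(1, 0) \<notin> ?R'"
      using a by simp
    then have "?R' \<noteq> UNIV"
      by blast
    ultimately have "?R' = R"
      by (intro mx) (auto simp: nontrivial_congruence_def intro: mu rf)
    moreover have "(b, 0) \<in> ?R'"
      using ab by simp
    ultimately show ?thesis by simp
  qed
  then show "R \<in> Spec"
    using nt by (auto simp: Spec_def prime_congruence_def)
qed

lemma topspace_Pr_s: "topspace (subtopology zariski_Pr Pr_s) = Pr_s"
  by (auto simp: topspace_zariski_Pr Pr_def Pr_s_def)

lemma topspace_MaxSpec: "topspace (subtopology zariski_Spec MaxSpec) = MaxSpec"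
  using MaxSpec_subset_Spec by (auto simp: topspace_zariski_Spec)

end

theory Submission
  imports Defs
begin

text \<open>
  Idempotence of addition makes a saturated ideal \<open>P\<close> closed downwards: if \<open>x + y\<close> is congruent
  to \<open>0\<close>, then \<open>x\<close> is congruent to \<open>x + (x + y) = x + y\<close>, hence to \<open>0\<close>. So for \<open>P\<close> prime, \<open>P\<close> and
  its complement form a quotient with the two classes of \<open>0\<close> and \<open>1\<close>, which is maximal since
  identifying \<open>0\<close> with \<open>1\<close> identifies everything. Conversely, any congruence \<open>R\<close> refines
  \<open>S_rel (ideal_of R)\<close>, so a maximal one equals it.
\<close>

lemma
  assumes "is_congruence R"
  shows congruence_refl: "(x, x) \<in> R"
    and congruence_sym: "(x, y) \<in> R \<Longrightarrow> (y, x) \<in> R"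
    and congruence_trans: "(x, y) \<in> R \<Longrightarrow> (y, z) \<in> R \<Longrightarrow> (x, z) \<in> R"
    and congruence_add: "(x, x') \<in> R \<Longrightarrow> (y, y') \<in> R \<Longrightarrow> (x + y, x' + y') \<in> R"
    and congruence_mult: "(x, x') \<in> R \<Longrightarrow> (y, y') \<in> R \<Longrightarrow> (x * y, x' * y') \<in> R"
  using assms unfolding is_congruence_def
  by (blast elim: equivE dest: reflD symD transD)+

lemma ideal_add: "is_ideal J \<Longrightarrow> x \<in> J \<Longrightarrow> y \<in> J \<Longrightarrow> x + y \<in> J"
  by (simp add: is_ideal_def)

lemma ideal_mult: "is_ideal J \<Longrightarrow> x \<in> J \<Longrightarrow> a * x \<in> J"
  by (simp add: is_ideal_def)

lemma saturated_add_left: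
  assumes "saturated J" "x + y \<in> J"
  shows "x \<in> J"
proof -
  obtain R where R: "is_congruence R" and J: "J = ideal_of R"
    using assms(1) by (auto simp: saturated_def)
  have xy: "(x + y, 0) \<in> R"
    using assms(2) by (simp add: J ideal_of_def)
  have "(x + (x + y), x + 0) \<in> R"
    by (rule congruence_add[OF R congruence_refl[OF R] xy])
  then have "(x + y, x) \<in> R"
    by (simp add: add.assoc[symmetric] add_idem)
  then have "(x, x + y) \<in> R"
    by (rule congruence_sym[OF R])
  then show ?thesis
    using congruence_trans[OF R _ xy] by (simp add: J ideal_of_def)
qed

text \<open>Together with \<open>prime_ideal_mult_iff\<close>, this says that membership of a sum or
  product depends only on the membership of its two terms, which is the compatibility of
  \<open>S_rel\<close> with both operations.\<close>

lemma saturated_add_iff: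
  assumes "saturated J"
  shows "x + y \<in> J \<longleftrightarrow> x \<in> J \<and> y \<in> J"
proof -
  have "is_ideal J"
    using assms by (simp add: saturated_def)
  then show ?thesis
    using saturated_add_left[OF assms, of x y] saturated_add_left[OF assms, of y x]
      ideal_add[of J x y] by (auto simp: add.commute)
qed

lemma prime_ideal_mult_iff:
  assumes "prime_ideal P"
  shows "x * y \<in> P \<longleftrightarrow> x \<in> P \<or> y \<in> P"
proof -
  have P: "is_ideal P"
    using assms by (simp add: prime_ideal_def)
  show ?thesis
    using assms ideal_mult[OF P, of y x] ideal_mult[OF P, of x y]
    by (auto simp: prime_ideal_def mult.commute)
qed

lemma zero_in_prime_ideal: "prime_ideal P \<Longrightarrow> 0 \<in> P"
  by (simp add: prime_ideal_def is_ideal_def)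

lemma one_notin_prime_ideal:
  assumes "prime_ideal P"
  shows "1 \<notin> P"
proof
  assume "1 \<in> P"
  then have "a \<in> P" for a
    using prime_ideal_mult_iff[OF assms, of a 1] by simp
  then show False
    using assms by (auto simp: prime_ideal_def)
qed

text \<open>Multiplying the relation between 0 and 1 by any \<open>x\<close> relates 0 to
  \<open>x\<close>, so all elements lie in the class of 0.\<close>

lemma congruence_zero_one:
  assumes R: "is_congruence R" and "(0, 1) \<in> R"
  shows "R = UNIV"
proof -
  have zero: "(0, x) \<in> R" for x
    using congruence_mult[OF R congruence_refl[OF R] assms(2), of x] by simp
  have "(x, y) \<in> R" for x y
    using congruence_trans[OF R congruence_sym[OF R zero] zero] .
  then show ?thesis
    by auto
qed

lemma is_congruence_S_rel:
  assumes "P \<in> Pr_s"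
  shows "is_congruence (S_rel P)"
proof -
  have "equiv UNIV (S_rel P)"
    by (rule equivI) (auto simp: S_rel_def refl_on_def sym_def trans_def)
  moreover have "prime_ideal P" "saturated P"
    using assms by (auto simp: Pr_s_def)
  ultimately show ?thesis
    by (auto simp: is_congruence_def S_rel_def saturated_add_iff prime_ideal_mult_iff)
qed

lemma ideal_of_S_rel:
  assumes "prime_ideal P"
  shows "ideal_of (S_rel P) = P"
  using zero_in_prime_ideal[OF assms] by (auto simp: ideal_of_def S_rel_def)

lemma nontrivial_congruence_S_rel:
  assumes "P \<in> Pr_s"
  shows "nontrivial_congruence (S_rel P)"
proof -
  have "prime_ideal P"
    using assms by (simp add: Pr_s_def)
  then have "(0, 1) \<notin> S_rel P"
    by (simp add: S_rel_def zero_in_prime_ideal one_notin_prime_ideal)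
  then show ?thesis
    using is_congruence_S_rel[OF assms] by (auto simp: nontrivial_congruence_def)
qed

lemma S_rel_in_MaxSpec:
  assumes "P \<in> Pr_s"
  shows "S_rel P \<in> MaxSpec"
proof -
  have P: "0 \<in> P" "1 \<notin> P"
    using assms by (auto simp: Pr_s_def zero_in_prime_ideal one_notin_prime_ideal)
  have "R' = S_rel P" if "nontrivial_congruence R'" and sub: "S_rel P \<subseteq> R'" for R'
  proof (rule ccontr)
    assume "R' \<noteq> S_rel P"
    have R': "is_congruence R'" "R' \<noteq> UNIV"
      using that by (auto simp: nontrivial_congruence_def)
    obtain x y where "(x, y) \<in> R'" "(x, y) \<notin> S_rel P"
      using sub \<open>R' \<noteq> S_rel P\<close> by auto
    \<comment> \<open>A pair outside \<open>S_rel P\<close> has exactly one entry in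
      \<open>P\<close>; symmetry of \<open>R'\<close> allows that entry to come first.\<close>
    then obtain u v where uv: "(u, v) \<in> R'" "u \<in> P" "v \<notin> P"
      using congruence_sym[OF R'(1), of x y] by (auto simp: S_rel_def)
    \<comment> \<open>Both pairs already lie in \<open>S_rel P\<close>, which gives the chain 0,
      \<open>u\<close>, \<open>v\<close>, 1 in \<open>R'\<close>.\<close>
    have "(0, u) \<in> R'" "(v, 1) \<in> R'"
      using sub P uv by (auto simp: S_rel_def)
    then have "(0, 1) \<in> R'"
      using uv(1) congruence_trans[OF R'(1)] by blast
    then show False
      using congruence_zero_one R' by blast
  qed
  then show ?thesis
    using nontrivial_congruence_S_rel[OF assms] by (simp add: MaxSpec_def)
qed

text \<open>The congruence \<open>R\<close> itself witnesses saturation; primality of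
  \<open>R\<close> passes to its ideal.\<close>

lemma ideal_of_in_Pr_s:
  assumes "prime_congruence R"
  shows "ideal_of R \<in> Pr_s"
  using assms prime_ideal_ideal_of[OF assms] is_ideal_ideal_of
  by (auto simp: Pr_s_def saturated_def prime_congruence_def nontrivial_congruence_def)

text \<open>By transitivity, related elements are either both related to 0 or both not.\<close>

lemma subset_S_rel_ideal_of:
  assumes R: "is_congruence R"
  shows "R \<subseteq> S_rel (ideal_of R)"
proof clarify
  fix x y
  assume xy: "(x, y) \<in> R"
  have "(x, 0) \<in> R \<longleftrightarrow> (y, 0) \<in> R"
    using congruence_trans[OF R xy] congruence_trans[OF R congruence_sym[OF R xy]] by blast
  then show "(x, y) \<in> S_rel (ideal_of R)"
    by (simp add: S_rel_def ideal_of_def)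
qed

lemma S_rel_ideal_of:
  assumes "R \<in> MaxSpec"
  shows "S_rel (ideal_of R) = R"
proof -
  have "prime_congruence R"
    using assms MaxSpec_subset_Spec by (auto simp: Spec_def)
  \<comment> \<open>Once this larger congruence is known to be nontrivial, maximality of
    \<open>R\<close> turns the inclusion into equality.\<close>
  then have "nontrivial_congruence (S_rel (ideal_of R))"
    by (intro nontrivial_congruence_S_rel ideal_of_in_Pr_s)
  then show ?thesis
    using assms subset_S_rel_ideal_of[of R]
    by (auto simp: MaxSpec_def nontrivial_congruence_def)
qed

text \<open>By \<open>V_eq\<close>, the preimage of \<open>W S\<close> is \<open>V S\<close>; this
  already works on all of \<open>Spec\<close>.\<close>

lemma continuous_map_ideal_of: "continuous_map zariski_Spec zariski_Pr ideal_of"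
  unfolding continuous_map_closedin topspace_zariski_Spec topspace_zariski_Pr
    closedin_zariski_Spec closedin_zariski_Pr
proof (intro conjI allI impI)
  show "ideal_of \<in> Spec \<rightarrow> Pr"
    by (auto simp: Spec_def Pr_def prime_ideal_ideal_of)
next
  fix C :: "'a set set"
  assume "\<exists>S. C = W S"
  then show "\<exists>S. {R \<in> Spec. ideal_of R \<in> C} = V S"
    by (auto simp: V_eq)
qed

text \<open>The preimage of \<open>V S\<close> is the trace of \<open>W S\<close>, because
  \<open>ideal_of\<close> recovers \<open>P\<close> from \<open>S_rel P\<close>. The domain is
  restricted to \<open>Pr_s\<close> because, for a prime \<open>P\<close> that is not saturated,
  \<open>S_rel P\<close> is not a congruence.\<close>

lemma continuous_map_S_rel:
  "continuous_map (subtopology zariski_Pr Pr_s) zariski_Spec S_rel"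
  unfolding continuous_map_closedin topspace_Pr_s topspace_zariski_Spec closedin_zariski_Spec
proof (intro conjI allI impI)
  show "S_rel \<in> Pr_s \<rightarrow> Spec"
    using S_rel_in_MaxSpec MaxSpec_subset_Spec by blast
next
  fix C :: "('a \<times> 'a) set set"
  assume "\<exists>S. C = V S"
  then obtain S where C: "C = V S" ..
  have "S_rel P \<in> V S \<longleftrightarrow> P \<in> W S" if P: "P \<in> Pr_s" for P
  proof -
    have "S_rel P \<in> Spec"
      using S_rel_in_MaxSpec[OF P] MaxSpec_subset_Spec by blast
    then show ?thesis
      using P by (simp add: V_eq ideal_of_S_rel Pr_s_def)
  qed
  then have "{P \<in> Pr_s. S_rel P \<in> C} = W S \<inter> Pr_s"
    by (auto simp: C)
  then show "closedin (subtopology zariski_Pr Pr_s) {P \<in> Pr_s. S_rel P \<in> C}"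
    by (auto simp: closedin_subtopology closedin_zariski_Pr)
qed

theorem theorem3p1:
  shows "bij_betw (S_rel :: 'a::b1_algebra set \<Rightarrow> ('a \<times> 'a) set) Pr_s MaxSpec
    \<and> bij_betw (ideal_of :: ('a \<times> 'a) set \<Rightarrow> 'a set) MaxSpec Pr_s
    \<and> (\<forall>P\<in>Pr_s. ideal_of (S_rel P) = (P :: 'a set))
    \<and> (\<forall>R\<in>MaxSpec. S_rel (ideal_of R) = (R :: ('a \<times> 'a) set))
    \<and> continuous_map (subtopology zariski_Pr Pr_s) (subtopology zariski_Spec MaxSpec)
        (S_rel :: 'a set \<Rightarrow> ('a \<times> 'a) set)
    \<and> continuous_map (subtopology zariski_Spec MaxSpec) (subtopology zariski_Pr Pr_s)
        (ideal_of :: ('a \<times> 'a) set \<Rightarrow> 'a set)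
    \<and> subtopology (zariski_Pr :: 'a set topology) Pr_s homeomorphic_space
        subtopology (zariski_Spec :: ('a \<times> 'a) set topology) MaxSpec"
proof -
  have \<alpha>: "S_rel P \<in> MaxSpec" if "P \<in> Pr_s" for P :: "'a set"
    using that by (rule S_rel_in_MaxSpec)
  have \<beta>: "ideal_of R \<in> Pr_s" if "R \<in> MaxSpec" for R :: "('a \<times> 'a) set"
    using that MaxSpec_subset_Spec by (auto simp: Spec_def intro: ideal_of_in_Pr_s)
  have \<beta>\<alpha>: "\<forall>P\<in>Pr_s. ideal_of (S_rel P) = (P :: 'a set)"
    by (simp add: Pr_s_def ideal_of_S_rel)
  have \<alpha>\<beta>: "\<forall>R\<in>MaxSpec. S_rel (ideal_of R) = (R :: ('a \<times> 'a) set)"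
    by (simp add: S_rel_ideal_of)
  \<comment> \<open>Continuity into a subspace is continuity into the ambient space together with
    containment of the image.\<close>
  have cont_\<alpha>: "continuous_map (subtopology zariski_Pr Pr_s) (subtopology zariski_Spec MaxSpec)
      (S_rel :: 'a set \<Rightarrow> ('a \<times> 'a) set)"
    using \<alpha> by (auto simp: continuous_map_in_subtopology continuous_map_S_rel topspace_Pr_s)
  have cont_\<beta>: "continuous_map (subtopology zariski_Spec MaxSpec) (subtopology zariski_Pr Pr_s)
      (ideal_of :: ('a \<times> 'a) set \<Rightarrow> 'a set)"
    using \<beta> by (auto simp: continuous_map_in_subtopology topspace_MaxSpec
      intro: continuous_map_from_subtopology continuous_map_ideal_of)
  have "homeomorphic_maps (subtopology zariski_Pr Pr_s) (subtopology zariski_Spec MaxSpec)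
      (S_rel :: 'a set \<Rightarrow> ('a \<times> 'a) set) ideal_of"
    unfolding homeomorphic_maps_def topspace_Pr_s topspace_MaxSpec
    using cont_\<alpha> cont_\<beta> \<beta>\<alpha> \<alpha>\<beta> by blast
  then have "subtopology (zariski_Pr :: 'a set topology) Pr_s homeomorphic_space
      subtopology (zariski_Spec :: ('a \<times> 'a) set topology) MaxSpec"
    unfolding homeomorphic_space_def by blast
  moreover have "bij_betw (S_rel :: 'a set \<Rightarrow> ('a \<times> 'a) set) Pr_s MaxSpec"
    \<comment> \<open>Each map serves as the inverse witness for the other.\<close>
    using \<alpha> \<beta> by (intro bij_betw_byWitness[OF \<beta>\<alpha> \<alpha>\<beta>]) auto
  moreover have "bij_betw (ideal_of :: ('a \<times> 'a) set \<Rightarrow> 'a set) MaxSpec Pr_s"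
    using \<alpha> \<beta> by (intro bij_betw_byWitness[OF \<alpha>\<beta> \<beta>\<alpha>]) auto
  ultimately show ?thesis
    using \<beta>\<alpha> \<alpha>\<beta> cont_\<alpha> cont_\<beta> by blast
qed

end
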